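(* For any non-negative real numbers $\delta$ and $c$, in the $(\delta+c)$-neighbourhood of a metric space $X\in\mathcal{GH}$ (with respect to the Gromov--Hausdorff distance) there exists a generic metric space $U$ such that $$\operatorname{s}(U)\geq \tfrac{\delta}{3}+2c,\qquad \operatorname{t}(U)\geq 2c,\qquad \operatorname{e}(U)\geq \tfrac{\delta}{3}.$$
   Context: Metric spaces are non-empty, have finite distances, and are otherwise arbitrary (not necessarily compact or bounded). The distance between points $x,y$ is written $|xy|$. Gromov--Hausdorff distance: for metric spaces $A,B$, $d_{GH}(A,B)\in[0,\infty]$ is the infimum of the Hausdorff distances $d_H(\tilde A,\tilde B)$ over all metric spaces $W$ and all subspaces $\tilde A,\tilde B\subseteq W$ isometric to $A$ and $B$ respectively. Here $d_H(\tilde A,\tilde B)=\inf\{r\ge 0:\tilde A\subseteq U_r(\tilde B),\ \tilde B\subseteq U_r(\tilde A)\}$, where $U_r(\cdot)$ denotes the $r$-neighbourhood of a set, i.e. the union of the open balls of radius $r$ centred at its points. The class $\mathcal{GH}$ is the proper class (in von Neumann--Bernays--Gödel set theory) of all metric spaces considered up to isometry, with $d_{GH}$ as generalized pseudometric. The $r$-neighbourhood of a space $X$ in $\mathcal{GH}$ is the open ball $\{Y: d_{GH}(X,Y)<r\}$. For a metric space $Y$ let $S(Y)$ be the set of all bijections of $Y$ onto itself, and for $f\in S(Y)$ let $\operatorname{dis} f=\sup\{\,\bigl||yy'|-|f(y)f(y')|\bigr| : y,y'\in Y\}$. Put $$\operatorname{s}(Y)=\inf\{|yy'| : y\neq y',\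 y,y'\in Y\},$$ $$\operatorname{t}(Y)=\inf\{|yy'|+|y'y''|-|yy''| : y,y',y''\in Y \text{ pairwise distinct}\},$$ $$\operatorname{e}(Y)=\inf\{\operatorname{dis} f : f\in S(Y),\ f\neq \operatorname{id}\},$$ with the convention $\inf\emptyset=+\infty$. A metric space $Y$ is called generic if $\operatorname{s}(Y)$, $\operatorname{t}(Y)$ and $\operatorname{e}(Y)$ are all positive.
   Formalization: The formal theorem assumes δ > 0 instead of δ ≥ 0: for δ = 0 the claim fails for every c (c = 0: the open ball of radius 0 is empty; c > 0: X = the real line has no U with s(U) ≥ 2c at distance < c). *)

theory Defs
  imports "HOL-Analysis.Analysis"
begin

definition nbhd :: "'a metric \<Rightarrow> real \<Rightarrow> 'a set \<Rightarrow> 'a set" where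
  "nbhd W r S = (\<Union>x\<in>S. mball_of W x r)"

definition hausdorff_dist :: "'a metric \<Rightarrow> 'a set \<Rightarrow> 'a set \<Rightarrow> ereal" where
  "hausdorff_dist W S T =
     Inf {ereal r | r. 0 \<le> r \<and> S \<subseteq> nbhd W r T \<and> T \<subseteq> nbhd W r S}"

definition isometric :: "'a metric \<Rightarrow> 'b metric \<Rightarrow> bool" where
  "isometric A B \<longleftrightarrow>
     (\<exists>f. bij_betw f (mspace A) (mspace B) \<and>
          (\<forall>x\<in>mspace A. \<forall>y\<in>mspace A. mdist B (f x) (f y) = mdist A x y))"

text \<open>
  The Gromov--Hausdorff distance is an infimum over \<^emph>\<open>all\<close> ambient metric spaces.
  A definition cannot quantify over types, so the ambient space ranges over the metric
  spaces carried by sets of elements of the sum type. This loses nothing: only the union of the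
  two copies matters, and it injects into the sum type. The lemma
  \<open>GH_dist_le_hausdorff_dist\<close> below shows that ambient spaces over any
  other type give no smaller value.
\<close>

definition GH_dist :: "'a metric \<Rightarrow> 'b metric \<Rightarrow> ereal" where
  "GH_dist A B =
     Inf {hausdorff_dist W S T | (W :: ('a + 'b) metric) S T.
            S \<subseteq> mspace W \<and> T \<subseteq> mspace W \<and>
            isometric (submetric W S) A \<and> isometric (submetric W T) B}"

lemma GH_dist_le_hausdorff_dist:
  fixes A :: "'a metric" and B :: "'b metric" and W :: "'c metric"
  assumes S: "S \<subseteq> mspace W" and T: "T \<subseteq> mspace W"
    and SA: "isometric (submetric W S) A" and TB: "isometric (submetric W T) B"
  shows "GH_dist A B \<le> hausdorff_dist W S T"
proof -
  have SW: "S \<inter> mspace W = S" "T \<inter> mspace W = T" using S T by auto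
  obtain f where f: "bij_betw f S (mspace A)"
      "\<And>x y. x \<in> S \<Longrightarrow> y \<in> S \<Longrightarrow> mdist A (f x) (f y) = mdist W x y"
    using SA unfolding isometric_def by (auto simp: SW)
  obtain h where h: "bij_betw h T (mspace B)"
      "\<And>x y. x \<in> T \<Longrightarrow> y \<in> T \<Longrightarrow> mdist B (h x) (h y) = mdist W x y"
    using TB unfolding isometric_def by (auto simp: SW)
  define g :: "'c \<Rightarrow> 'a + 'b" where "g w = (if w \<in> S then Inl (f w) else Inr (h w))" for w
  define k where "k = inv_into (S \<union> T) g"
  have inj: "inj_on g (S \<union> T)"
    using f(1) h(1) unfolding inj_on_def g_def bij_betw_def by (auto split: if_splits)
  have kg: "k (g w) = w" if "w \<in> S \<union> T" for w
    unfolding k_def using inj that by (rule inv_into_f_f)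
  interpret V: Metric_space "g ` (S \<union> T)" "\<lambda>p q. mdist W (k p) (k q)"
  proof
    fix p q r
    show "0 \<le> mdist W (k p) (k q)" by simp
    show "mdist W (k p) (k q) = mdist W (k q) (k p)" by (rule mdist_commute)
    assume p: "p \<in> g ` (S \<union> T)" and q: "q \<in> g ` (S \<union> T)"
    then obtain a b where ab: "a \<in> S \<union> T" "b \<in> S \<union> T" "p = g a" "q = g b" by blast
    then show "mdist W (k p) (k q) = 0 \<longleftrightarrow> p = q"
      using S T inj by (auto simp: kg mdist_zero subset_iff dest: inj_onD)
    assume "r \<in> g ` (S \<union> T)"
    then obtain c where "c \<in> S \<union> T" "r = g c" by blast
    then show "mdist W (k p) (k r) \<le> mdist W (k p) (k q) + mdist W (k q) (k r)"
      using ab S T by (metis kg mdist_triangle Un_least subsetD)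
  qed
  define V' where "V' = metric (g ` (S \<union> T), \<lambda>p q. mdist W (k p) (k q))"
  have V': "mspace V' = g ` (S \<union> T)" "mdist V' = (\<lambda>p q. mdist W (k p) (k q))"
    unfolding V'_def by simp_all
  have iso: "isometric (submetric V' (g ` R)) C"
    if R: "R \<subseteq> S \<union> T" and j: "bij_betw j R (mspace C)"
      "\<And>x y. x \<in> R \<Longrightarrow> y \<in> R \<Longrightarrow> mdist C (j x) (j y) = mdist W x y"
    for R :: "'c set" and C :: "'d metric" and j
    unfolding isometric_def
  proof (intro exI conjI ballI)
    have sub: "g ` R \<inter> mspace V' = g ` R" using R V' by auto
    have "bij_betw k (g ` R) R"
      by (rule bij_betw_byWitness[where f' = g]) (use R kg in auto)
    then show "bij_betw (j \<circ> k) (mspace (submetric V' (g ` R))) (mspace C)"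
      using j(1) by (simp add: sub bij_betw_trans)
    fix x y
    assume "x \<in> mspace (submetric V' (g ` R))" "y \<in> mspace (submetric V' (g ` R))"
    then obtain a b where ab: "a \<in> R" "b \<in> R" "x = g a" "y = g b" by (auto simp: sub)
    then have "k x = a" "k y = b" using R kg by auto
    then show "mdist C ((j \<circ> k) x) ((j \<circ> k) y) = mdist (submetric V' (g ` R)) x y"
      using ab by (simp add: V' j(2))
  qed
  have nb: "g ` R \<subseteq> nbhd V' r (g ` R')"
    if RR': "R \<subseteq> nbhd W r R'" "R \<subseteq> S \<union> T" "R' \<subseteq> S \<union> T" for R R' r
  proof
    fix p assume "p \<in> g ` R"
    then obtain a where a: "a \<in> R" "p = g a" by blast
    then obtain b where b: "b \<in> R'" "mdist W b a < r"
      using RR' unfolding nbhd_def by auto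
    have "g a \<in> mspace V'" "g b \<in> mspace V'" "mdist V' (g b) (g a) < r"
      using a b RR' V' kg by (auto simp: subset_iff)
    then show "p \<in> nbhd V' r (g ` R')"
      using a b unfolding nbhd_def by auto
  qed
  have "hausdorff_dist V' (g ` S) (g ` T) \<le> hausdorff_dist W S T"
    unfolding hausdorff_dist_def by (rule Inf_superset_mono) (use nb in blast)
  moreover have "GH_dist A B \<le> hausdorff_dist V' (g ` S) (g ` T)"
    unfolding GH_dist_def
    by (rule Inf_lower) (use iso[OF _ f] iso[OF _ h] V' in blast)
  ultimately show ?thesis by (rule order_trans[rotated])
qed

definition distortion :: "'a metric \<Rightarrow> ('a \<Rightarrow> 'a) \<Rightarrow> ereal" where
  "distortion Y f =
     Sup {ereal \<bar>mdist Y y y' - mdist Y (f y) (f y')\<bar> | y y'. y \<in> mspace Y \<and> y' \<in> mspace Y}"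

text \<open>In \<^typ>\<open>ereal\<close> the infimum of the empty set is \<open>\<infinity>\<close>.\<close>

definition s_inv :: "'a metric \<Rightarrow> ereal" where
  "s_inv Y = Inf {ereal (mdist Y y y') | y y'. y \<in> mspace Y \<and> y' \<in> mspace Y \<and> y \<noteq> y'}"

definition t_inv :: "'a metric \<Rightarrow> ereal" where
  "t_inv Y =
     Inf {ereal (mdist Y y y' + mdist Y y' y'' - mdist Y y y'') | y y' y''.
            y \<in> mspace Y \<and> y' \<in> mspace Y \<and> y'' \<in> mspace Y \<and>
            y \<noteq> y' \<and> y' \<noteq> y'' \<and> y \<noteq> y''}"

text \<open>
  A bijection of \<open>mspace Y\<close> onto itself is represented by its extension by the identity
  outside \<open>mspace Y\<close>, so being different from \<open>id\<close> means moving some point of \<open>Y\<close>.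
\<close>

definition e_inv :: "'a metric \<Rightarrow> ereal" where
  "e_inv Y = Inf {distortion Y f | f. f permutes mspace Y \<and> f \<noteq> id}"

definition generic :: "'a metric \<Rightarrow> bool" where
  "generic Y \<longleftrightarrow> 0 < s_inv Y \<and> 0 < t_inv Y \<and> 0 < e_inv Y"

end

theory Submission
  imports Defs
begin

text \<open>
  Put \<open>h = \<delta> / 3\<close> and blow up every point of \<open>X\<close> to countably many copies.
  Rounding distances up to multiples of \<open>2 h\<close> and adding \<open>2 c + 2 h\<close>,
  or \<open>2 c + 3 h\<close> along the edges of a graph, changes them by at most
  \<open>2 c + 5 h < 2 (c + \<delta>)\<close>, hence moves the space by less than \<open>c + \<delta>\<close>.
  The added constants provide the bounds on \<open>s\<close> and \<open>t\<close>.
  Between distinct points the new distances lie in \<open>2 c + h \<int>\<close> and the parity of the multiple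
  of \<open>h\<close> shows whether the pair is an edge, so a bijection of distortion less than \<open>h\<close> is an
  automorphism of the graph. It remains to choose the graph without nontrivial automorphisms:
  well-order the points, colour the successors of each limit point alternately with two
  colours, and join \<open>u < v\<close> iff \<open>u\<close> has the first colour.
\<close>

section \<open>A graph without nontrivial automorphisms from a coloured well-order\<close>

definition colour_edge :: "('v \<times> 'v) set \<Rightarrow> ('v \<Rightarrow> bool) \<Rightarrow> 'v \<Rightarrow> 'v \<Rightarrow> bool" where
  "colour_edge L p u v \<longleftrightarrow> (u, v) \<in> L \<and> p u \<or> (v, u) \<in> L \<and> p v"

lemma colour_edge_commute: "colour_edge L p u v = colour_edge L p v u"
  unfolding colour_edge_def by blast

text \<open>Take the \<open>L\<close>-least moved point \<open>v\<close> and \<open>w = f v\<close>.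
  Everything below \<open>v\<close> is fixed, so injectivity forces \<open>w\<close> above
  \<open>v\<close>. Testing the adjacencies of \<open>w\<close> at \<open>succ w\<close> and at
  \<open>succ v\<close> then gives contradictory colours.\<close>

lemma colour_edge_rigid:
  assumes wf: "wf L" and trans: "trans L" and total: "total_on V L"
    and succ: "\<And>v. v \<in> V \<Longrightarrow> succ v \<in> V" "\<And>v. v \<in> V \<Longrightarrow> (v, succ v) \<in> L"
      "\<And>v w. v \<in> V \<Longrightarrow> w \<in> V \<Longrightarrow> (v, w) \<in> L \<Longrightarrow> w = succ v \<or> (succ v, w) \<in> L"
    and alt: "\<And>v. v \<in> V \<Longrightarrow> p (succ v) \<longleftrightarrow> \<not> p v"
    and f: "f permutes V"
    and edge: "\<And>u v. u \<in> V \<Longrightarrow> v \<in> V \<Longrightarrow> u \<noteq> v \<Longrightarrow>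
      colour_edge L p (f u) (f v) = colour_edge L p u v"
  shows "f = id"
proof (rule ccontr)
  assume "f \<noteq> id"
  then obtain x where x: "x \<in> {v \<in> V. f v \<noteq> v}"
    using permutes_not_in[OF f] by fastforce
  from wf[unfolded wf_eq_minimal, rule_format, OF x]
  obtain v where "v \<in> {v \<in> V. f v \<noteq> v}" "\<forall>u. (u, v) \<in> L \<longrightarrow> u \<notin> {v \<in> V. f v \<noteq> v}"
    by (rule bexE)
  then have v: "v \<in> V" "f v \<noteq> v" and least: "\<And>u. (u, v) \<in> L \<Longrightarrow> u \<in> V \<Longrightarrow> f u = u"
    by blast+
  have asym: "(y, x) \<notin> L" if "(x, y) \<in> L" for x y
    using wf that by (rule wf_asym)
  have inj: "f x = f y \<longleftrightarrow> x = y" for x y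
    using permutes_inj[OF f] by (auto dest: injD)
  have edge_less: "colour_edge L p x y = p x" if "(x, y) \<in> L" for x y
    using that asym[OF that] by (simp add: colour_edge_def)
  define w where "w = f v"
  have w: "w \<in> V" using permutes_in_image[OF f] v by (simp add: w_def)
  have "(w, v) \<notin> L"
    using least w v inj by (metis w_def)
  then have vw: "(v, w) \<in> L"
    using total v w unfolding total_on_def w_def by metis
  \<comment> \<open>\<open>v\<close> is related in the same way, given by \<open>p v\<close>, to all
    later points. Since \<open>f\<close> fixes the points below \<open>v\<close>, it carries this
    constant row to \<open>w\<close> and all \<open>z\<close> not below \<open>v\<close>, including
    those between \<open>v\<close> and \<open>w\<close>, where adjacency is decided by
    \<open>p z\<close>.\<close>
  have row: "colour_edge L p w z = p v" if z: "z \<in> V" "(z, v) \<notin> L" "z \<noteq> w" for z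
  proof -
    obtain x where x: "x \<in> V" "z = f x"
      using permutes_image[OF f] z by blast
    have "x \<noteq> v" using x z w_def by auto
    moreover have "(x, v) \<notin> L" using least x z by metis
    ultimately have "(v, x) \<in> L" using total v x unfolding total_on_def by metis
    then have "colour_edge L p v x = p v" by (rule edge_less)
    then show ?thesis using edge[of v x] v x \<open>x \<noteq> v\<close> by (simp add: w_def)
  qed
  have "(v, succ w) \<in> L" using vw succ(2)[OF w] trans by (meson transD)
  then have "colour_edge L p w (succ w) = p v"
    using succ(1,2)[OF w] asym[of v "succ w"] asym[of w "succ w"] by (intro row) auto
  then have pw: "p w = p v" using edge_less[OF succ(2)[OF w]] by simp
  \<comment> \<open>Equal colours rule out \<open>succ v\<close> because colours alternate. Hence
    \<open>succ v\<close> lies strictly between \<open>v\<close> and \<open>w\<close> and is a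
    legitimate test point with the wrong colour.\<close>
  then have "w \<noteq> succ v" using alt[OF v(1)] by auto
  then have "(succ v, w) \<in> L" using succ(3)[OF v(1) w vw] by blast
  then have "colour_edge L p w (succ v) = p (succ v)"
    using edge_less colour_edge_commute by metis
  moreover have "colour_edge L p w (succ v) = p v"
    using succ(1,2)[OF v(1)] asym[of v "succ v"] \<open>w \<noteq> succ v\<close> by (intro row) auto
  ultimately show False using alt[OF v(1)] by simp
qed

text \<open>In the lexicographic order each fibre over a point of \<open>S\<close> is a block of
  type omega. So \<open>(x, n + 1)\<close> is the immediate successor of \<open>(x, n)\<close>
  whatever the cardinality of \<open>S\<close>, and the parity of \<open>n\<close> alternates along
  successors.\<close>

lemma ex_rigid_graph:
  "\<exists>E :: 'a \<times> nat \<Rightarrow> 'a \<times> nat \<Rightarrow> bool. (\<forall>u v. E u v = E v u) \<and>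
     (\<forall>f. f permutes (S \<times> UNIV) \<longrightarrow> f \<noteq> id \<longrightarrow>
       (\<exists>u\<in>S \<times> UNIV. \<exists>v\<in>S \<times> UNIV. u \<noteq> v \<and> E (f u) (f v) \<noteq> E u v))"
proof -
  obtain r :: "'a rel" where r: "well_order_on UNIV r"
    using well_order_on by blast
  define L where "L = (r - Id) <*lex*> less_than"
  have lin: "trans r" "antisym r" "total r" "wf (r - Id)"
    using r unfolding well_order_on_def linear_order_on_def partial_order_on_def preorder_on_def
    by auto
  have wf: "wf L" unfolding L_def using lin by (intro wf_lex_prod) auto
  have tr: "trans L" unfolding L_def using lin by (intro trans_lex_prod trans_diff_Id) auto
  have tot: "total_on (S \<times> UNIV) L"
    using lin(3) unfolding L_def total_on_def by auto
  define succ :: "'a \<times> nat \<Rightarrow> 'a \<times> nat" where "succ = apsnd Suc"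
  have rigid: "f = id" if "f permutes (S \<times> UNIV)"
    and "\<And>u v. u \<in> S \<times> UNIV \<Longrightarrow> v \<in> S \<times> UNIV \<Longrightarrow> u \<noteq> v \<Longrightarrow>
      colour_edge L (even \<circ> snd) (f u) (f v) = colour_edge L (even \<circ> snd) u v" for f
    by (rule colour_edge_rigid[OF wf tr tot _ _ _ _ that, of succ])
      (auto simp: succ_def L_def)
  show ?thesis
    by (intro exI[of _ "colour_edge L (even \<circ> snd)"] conjI allI impI colour_edge_commute)
      (use rigid in blast)
qed

section \<open>An upper bound for the Gromov--Hausdorff distance\<close>

text \<open>
  The two spaces are glued by setting \<open>|x y| = |x f(y)| + \<rho>\<close> for \<open>x\<close> in \<open>A\<close> and \<open>y\<close> in \<open>B\<close>.
\<close>

lemma GH_dist_le_of_map: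
  assumes f: "f ` mspace B = mspace A" and \<rho>: "0 < \<rho>"
    and lower: "\<And>u v. u \<in> mspace B \<Longrightarrow> v \<in> mspace B \<Longrightarrow> mdist A (f u) (f v) \<le> mdist B u v"
    and upper: "\<And>u v. u \<in> mspace B \<Longrightarrow> v \<in> mspace B \<Longrightarrow>
      mdist B u v \<le> mdist A (f u) (f v) + 2 * \<rho>"
  shows "GH_dist A B \<le> ereal \<rho>"
proof -
  define M where "M = Inl ` mspace A \<union> Inr ` mspace B"
  define D where "D p q = (case (p, q) of
      (Inl x, Inl y) \<Rightarrow> mdist A x y | (Inr u, Inr v) \<Rightarrow> mdist B u v
    | (Inl x, Inr u) \<Rightarrow> mdist A x (f u) + \<rho> | (Inr u, Inl x) \<Rightarrow> mdist A x (f u) + \<rho>)" for p q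
  have D: "D (Inl x) (Inl y) = mdist A x y" "D (Inr u) (Inr v) = mdist B u v"
    "D (Inl x) (Inr u) = mdist A x (f u) + \<rho>" "D (Inr u) (Inl x) = mdist A x (f u) + \<rho>"
    for x y u v by (simp_all add: D_def)
  have fA: "f u \<in> mspace A" if "u \<in> mspace B" for u using f that by blast
  interpret W: Metric_space M D
  proof
    fix p q r
    show "0 \<le> D p q" using \<rho> by (cases p; cases q) (auto simp: D)
    show "D p q = D q p" by (cases p; cases q) (auto simp: D mdist_commute)
    assume p: "p \<in> M" and q: "q \<in> M"
    show "D p q = 0 \<longleftrightarrow> p = q"
    proof (cases p; cases q)
      fix x u assume "p = Inl x" "q = Inr u"
      then show ?thesis using \<rho> mdist_nonneg[of A x "f u"] by (simp add: D del: mdist_nonneg)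
    next
      fix x u assume "p = Inr u" "q = Inl x"
      then show ?thesis using \<rho> mdist_nonneg[of A x "f u"] by (simp add: D del: mdist_nonneg)
    qed (use p q in \<open>auto simp: D M_def\<close>)
    assume r: "r \<in> M"
    have tri: "mdist A a e \<le> mdist A a b + mdist A b e"
      if "a \<in> mspace A" "b \<in> mspace A" "e \<in> mspace A" for a b e
      using that by (rule mdist_triangle)
    show "D p r \<le> D p q + D q r"
    proof (cases p; cases q; cases r)
      fix x y z assume "p = Inl x" "q = Inl y" "r = Inl z"
      then show ?thesis using tri p q r by (auto simp: D M_def)
    next
      fix x y z assume "p = Inl x" "q = Inl y" "r = Inr z"
      then show ?thesis using tri[of x y "f z"] fA p q r by (auto simp: D M_def)
    next
      fix x y z assume "p = Inl x" "q = Inr y" "r = Inl z"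
      then show ?thesis using tri[of x "f y" z] fA p q r \<rho> by (auto simp: D M_def mdist_commute)
    next
      fix x y z assume "p = Inl x" "q = Inr y" "r = Inr z"
      then show ?thesis using tri[of x "f y" "f z"] lower[of y z] fA p q r
        by (auto simp: D M_def)
    next
      fix x y z assume "p = Inr x" "q = Inl y" "r = Inl z"
      then show ?thesis using tri[of z y "f x"] fA p q r by (auto simp: D M_def mdist_commute)
    next
      \<comment> \<open>A detour from \<open>B\<close> through \<open>A\<close> pays \<rho> twice;
        this is where the allowed excess of 2 \<rho> in \<open>upper\<close> comes from.\<close>
      fix x y z assume "p = Inr x" "q = Inl y" "r = Inr z"
      then show ?thesis using tri[of "f x" y "f z"] upper[of x z] fA p q r
        by (auto simp: D M_def mdist_commute)
    next
      fix x y z assume "p = Inr x" "q = Inr y" "r = Inl z"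
      then show ?thesis using tri[of z "f y" "f x"] lower[of y x] fA p q r
        by (auto simp: D M_def mdist_commute)
    next
      fix x y z assume "p = Inr x" "q = Inr y" "r = Inr z"
      then show ?thesis using mdist_triangle[of x B y z] p q r by (auto simp: D M_def)
    qed
  qed
  define W where "W = metric (M, D)"
  have W: "mspace W = M" "mdist W = D" unfolding W_def by simp_all
  have sub: "Inl ` mspace A \<subseteq> mspace W" "Inr ` mspace B \<subseteq> mspace W"
    by (auto simp: W M_def)
  have isoA: "isometric (submetric W (Inl ` mspace A)) A"
    unfolding isometric_def using sub
    by (intro exI[of _ projl]) (auto simp: W D Int_absorb2 bij_betw_def inj_on_def image_image)
  have isoB: "isometric (submetric W (Inr ` mspace B)) B"
    unfolding isometric_def using sub
    by (intro exI[of _ projr]) (auto simp: W D Int_absorb2 bij_betw_def inj_on_def image_image)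
  \<comment> \<open>\<open>u\<close> and \<open>f u\<close> are at distance exactly \<rho>, and
    neighbourhoods are unions of open balls, so only radii above \<rho> are admissible; the infimum
    still gives \<rho>.\<close>
  have bound: "hausdorff_dist W (Inl ` mspace A) (Inr ` mspace B) \<le> ereal r" if r: "\<rho> < r" for r
    unfolding hausdorff_dist_def
  proof (rule Inf_lower, intro CollectI exI[of _ r] conjI refl subsetI)
    show "0 \<le> r" using \<rho> r by simp
    have close: "D (Inl (f u)) (Inr u) < r" "D (Inr u) (Inl (f u)) < r" if "u \<in> mspace B" for u
      using mdist_zero[OF fA fA, OF that that] r by (simp_all add: D)
    fix p
    show "p \<in> nbhd W r (Inr ` mspace B)" if "p \<in> Inl ` mspace A"
    proof -
      from that obtain x where x: "x \<in> mspace A" "p = Inl x" by blast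
      obtain u where u: "u \<in> mspace B" "x = f u" using x(1) f by blast
      have "p \<in> mball_of W (Inr u) r" using close[OF u(1)] fA[OF u(1)] x u by (simp add: W M_def)
      then show ?thesis unfolding nbhd_def using u by blast
    qed
    show "p \<in> nbhd W r (Inl ` mspace A)" if "p \<in> Inr ` mspace B"
    proof -
      from that obtain u where u: "u \<in> mspace B" "p = Inr u" by blast
      have "p \<in> mball_of W (Inl (f u)) r" using close[OF u(1)] fA[OF u(1)] u by (simp add: W M_def)
      then show ?thesis unfolding nbhd_def using fA[OF u(1)] by blast
    qed
  qed
  show ?thesis
  proof (rule ereal_le_epsilon2)
    fix e :: real assume "0 < e"
    have "GH_dist A B \<le> hausdorff_dist W (Inl ` mspace A) (Inr ` mspace B)"
      using sub isoA isoB by (rule GH_dist_le_hausdorff_dist)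
    also have "\<dots> \<le> ereal (\<rho> + e)" using bound \<open>0 < e\<close> by simp
    finally show "GH_dist A B \<le> ereal \<rho> + ereal e" by simp
  qed
qed

section \<open>The rounded metric and its invariants\<close>

theorem theorem19:
  fixes X :: "'a metric" and \<delta> c :: real
  assumes "mspace X \<noteq> {}" and "0 < \<delta>" and "0 \<le> c"
  shows "\<exists>U :: ('a \<times> nat) metric.
           mspace U \<noteq> {} \<and>
           GH_dist X U < ereal (\<delta> + c) \<and>
           generic U \<and>
           s_inv U \<ge> ereal (\<delta> / 3 + 2 * c) \<and>
           t_inv U \<ge> ereal (2 * c) \<and>
           e_inv U \<ge> ereal (\<delta> / 3)"
proof -
  define h where "h = \<delta> / 3"
  have h: "0 < h" using assms by (simp add: h_def)
  define V where "V = mspace X \<times> (UNIV :: nat set)"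
  obtain E :: "'a \<times> nat \<Rightarrow> 'a \<times> nat \<Rightarrow> bool" where E: "\<And>u v. E u v = E v u"
    and rigid: "\<And>f. f permutes V \<Longrightarrow> f \<noteq> id \<Longrightarrow>
      \<exists>u\<in>V. \<exists>v\<in>V. u \<noteq> v \<and> E (f u) (f v) \<noteq> E u v"
    using ex_rigid_graph[of "mspace X"] unfolding V_def by blast
  define d where "d u v = mdist X (fst u) (fst v)" for u v :: "'a \<times> nat"
  \<comment> \<open>The even part stores the rounded distance, the last bit stores the edge. The
    constant 2 exceeds the largest bit by 1, which leaves slack in the triangle inequality.\<close>
  define k where "k u v = 2 * \<lceil>d u v / (2 * h)\<rceil> + 2 + of_bool (E u v)" for u v
  define D where "D u v = (if u = v then 0 else 2 * c + h * of_int (k u v))" for u v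
  have d_comm: "d u v = d v u" for u v by (simp add: d_def mdist_commute)
  have d_tri: "d u w \<le> d u v + d v w" if "u \<in> V" "v \<in> V" "w \<in> V" for u v w
    using that mdist_triangle[of "fst u" X "fst v" "fst w"] by (auto simp: d_def V_def)
  have d_self: "d u u = 0" if "u \<in> V" for u
    using that by (auto simp: d_def V_def)
  have d_nonneg: "0 \<le> d u v" for u v by (simp add: d_def)
  have k2: "2 \<le> k u v" for u v
  proof -
    have "0 \<le> \<lceil>d u v / (2 * h)\<rceil>" using d_nonneg[of u v] h by (simp add: le_ceiling_iff)
        (smt (verit) divide_nonneg_pos)
    then show ?thesis by (simp add: k_def)
  qed
  \<comment> \<open>Ceilings are subadditive, and the constants contribute at least 2 + 2 - 3 =
    1.\<close>
  have k_tri: "k u w + 1 \<le> k u v + k v w" if "u \<in> V" "v \<in> V" "w \<in> V" for u v w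
  proof -
    have "d u w / (2 * h) \<le> d u v / (2 * h) + d v w / (2 * h)"
      using d_tri[OF that] h by (simp add: divide_right_mono flip: add_divide_distrib)
    then have "\<lceil>d u w / (2 * h)\<rceil> \<le> \<lceil>d u v / (2 * h)\<rceil> + \<lceil>d v w / (2 * h)\<rceil>"
      by (rule order_trans[OF ceiling_mono ceiling_add_le])
    then show ?thesis by (simp add: k_def of_bool_def)
  qed
  have k_lower: "d u v \<le> h * of_int (k u v)" for u v
  proof -
    have "d u v / (2 * h) \<le> of_int \<lceil>d u v / (2 * h)\<rceil>" by (rule le_of_int_ceiling)
    then have "2 * h * (d u v / (2 * h)) \<le> 2 * h * of_int \<lceil>d u v / (2 * h)\<rceil>"
      using h by (intro mult_left_mono) auto
    then have "d u v \<le> h * (2 * of_int \<lceil>d u v / (2 * h)\<rceil>)"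
      using h by (simp add: mult_ac)
    also have "\<dots> \<le> h * of_int (k u v)" using h by (intro mult_left_mono) (auto simp: k_def)
    finally show ?thesis .
  qed
  \<comment> \<open>Rounding costs at most \<open>2 * h\<close>, the constant and the edge bit at
    most \<open>3 * h\<close>.\<close>
  have k_upper: "h * of_int (k u v) \<le> d u v + 5 * h" for u v
  proof -
    have "of_int \<lceil>d u v / (2 * h)\<rceil> \<le> d u v / (2 * h) + 1" by (rule of_int_ceiling_le_add_one)
    then have "2 * h * of_int \<lceil>d u v / (2 * h)\<rceil> \<le> 2 * h * (d u v / (2 * h) + 1)"
      using h by (intro mult_left_mono) auto
    then have "h * (2 * of_int \<lceil>d u v / (2 * h)\<rceil>) \<le> d u v + 2 * h"
      using h by (simp add: distrib_left mult_ac)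
    moreover have "h * of_int (k u v) \<le> h * (2 * of_int \<lceil>d u v / (2 * h)\<rceil> + 3)"
      using h by (intro mult_left_mono) (auto simp: k_def)
    ultimately show ?thesis by (simp add: algebra_simps)
  qed
  have D_ge: "2 * h + 2 * c \<le> D u v" if "u \<noteq> v" for u v
  proof -
    have "h * of_int 2 \<le> h * of_int (k u v)"
      using k2[of u v] h by (intro mult_left_mono) (simp_all only: of_int_le_iff)
    then show ?thesis using that by (simp add: D_def)
  qed
  have D_comm: "D u v = D v u" for u v
    unfolding D_def k_def using d_comm[of u v] E[of u v] by simp
  have D_tri: "2 * c + h \<le> D u v + D v w - D u w"
    if "u \<in> V" "v \<in> V" "w \<in> V" "u \<noteq> v" "v \<noteq> w" "u \<noteq> w" for u v w
  proof -
    have "h * of_int (k u w + 1) \<le> h * of_int (k u v + k v w)"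
      using k_tri[of u v w] that h by (intro mult_left_mono) (simp_all only: of_int_le_iff)
    then show ?thesis using that by (simp add: D_def algebra_simps)
  qed
  interpret U: Metric_space V D
  proof
    fix u v w
    show "0 \<le> D u v" using D_ge[of u v] h assms by (cases "u = v") (simp add: D_def, linarith)
    show "D u v = D v u" by (rule D_comm)
    assume uv: "u \<in> V" "v \<in> V"
    show "D u v = 0 \<longleftrightarrow> u = v" using D_ge[of u v] h assms by (cases "u = v") (simp add: D_def, linarith)
    assume "w \<in> V"
    \<comment> \<open>\<open>D_tri\<close> covers only pairwise distinct points; the degenerate
      triangles use \<open>D_ge\<close> and symmetry.\<close>
    then show "D u w \<le> D u v + D v w"
      using uv D_tri[of u v w] D_ge[of u v] D_comm[of u v] h assms
      by (cases "u = v"; cases "v = w"; cases "u = w") (auto simp: D_def[of v v] D_def[of w w])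
  qed
  define U where "U = metric (V, D)"
  have U: "mspace U = V" "mdist U = D" unfolding U_def by simp_all
  \<comment> \<open>The radius is half of the total excess \<open>2 * c + 5 * h\<close>. As
    \<open>5 * h / 2 < 3 * h\<close> and \<open>3 * h\<close> equals \<delta>, the final bound is
    strict.\<close>
  have "GH_dist X U \<le> ereal (c + 5 * h / 2)"
  proof (rule GH_dist_le_of_map)
    show "fst ` mspace U = mspace X" unfolding U V_def by simp
    show "0 < c + 5 * h / 2" using h assms by simp
    fix u v
    show "mdist X (fst u) (fst v) \<le> mdist U u v" if "u \<in> mspace U" "v \<in> mspace U"
      using that k_lower[of u v] d_self[of u] assms
      by (auto simp: U D_def simp flip: d_def)
    show "mdist U u v \<le> mdist X (fst u) (fst v) + 2 * (c + 5 * h / 2)"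
      if "u \<in> mspace U" "v \<in> mspace U"
      using k_upper[of u v] h assms by (auto simp: U D_def d_def)
  qed
  also have "\<dots> < ereal (\<delta> + c)" using assms by (simp add: h_def)
  finally have GH: "GH_dist X U < ereal (\<delta> + c)" .
  have s: "ereal (2 * h + 2 * c) \<le> s_inv U"
    unfolding s_inv_def U using D_ge by (intro Inf_greatest) auto
  have t: "ereal (2 * c + h) \<le> t_inv U"
    unfolding t_inv_def U using D_tri by (intro Inf_greatest) auto
  have e: "ereal h \<le> e_inv U"
    unfolding e_inv_def U
  proof (rule Inf_greatest, clarify)
    fix f assume f: "f permutes V" "f \<noteq> id"
    from rigid[OF f] obtain u v where uv: "u \<in> V" "v \<in> V" "u \<noteq> v" "E (f u) (f v) \<noteq> E u v"
      by (elim bexE conjE)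
    have parity: "even (k x y) \<longleftrightarrow> \<not> E x y" for x y by (simp add: k_def)
    have "k u v \<noteq> k (f u) (f v)" using uv(4) parity[of u v] parity[of "f u" "f v"] by auto
    then have "1 \<le> \<bar>k u v - k (f u) (f v)\<bar>" by simp
    then have "h * of_int 1 \<le> h * of_int \<bar>k u v - k (f u) (f v)\<bar>"
      using h by (intro mult_left_mono) (simp_all only: of_int_le_iff)
    also have "\<dots> = \<bar>h * (of_int (k u v) - of_int (k (f u) (f v)))\<bar>"
      using h by (simp add: abs_mult)
    \<comment> \<open>Injectivity keeps \<open>f u\<close> and \<open>f v\<close> distinct, so both
      distances carry the offset \<open>2 * c\<close>, which cancels.\<close>
    also have "\<dots> = \<bar>D u v - D (f u) (f v)\<bar>"
      using uv permutes_inj[OF f(1)] by (auto simp: D_def algebra_simps dest: injD)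
    finally have "ereal h \<le> ereal \<bar>D u v - D (f u) (f v)\<bar>" by simp
    also have "\<dots> \<le> distortion U f"
      unfolding distortion_def U using uv by (intro Sup_upper) blast
    finally show "ereal h \<le> distortion U f" .
  qed
  \<comment> \<open>The extra \<open>h\<close> in the bound for \<open>t_inv\<close> matters when
    \<open>c = 0\<close>, where the bound \<open>2 * c\<close> alone would not give
    positivity.\<close>
  have pos: "0 < ereal (2 * h + 2 * c)" "0 < ereal (2 * c + h)" "0 < ereal h"
    using h assms by simp_all
  have "generic U"
    unfolding generic_def using s t e pos by (meson less_le_trans)
  moreover have "ereal (\<delta> / 3 + 2 * c) \<le> s_inv U"
    using s by (rule order_trans[rotated]) (use h in \<open>simp add: h_def\<close>)
  moreover have "ereal (2 * c) \<le> t_inv U"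
    using t by (rule order_trans[rotated]) (use h in simp)
  moreover have "mspace U \<noteq> {}" using assms by (simp add: U V_def)
  ultimately show ?thesis using GH e unfolding h_def by blast
qed

end
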